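(* Let $G$ be a connected graph. The following statements are equivalent: (i) every independent set of $G$ is a total mutual-visibility set; (ii) every independent set of $G$ is a dual mutual-visibility set; (iii) $G$ is a dense diamond graph.
   Context: All graphs are finite and simple. For $X\subseteq V(G)$, two vertices $u,v$ are $X$-visible if there is a shortest $u,v$-path $P$ with $V(P)\cap X\subseteq\{u,v\}$. $X$ is a total mutual-visibility set if any two vertices of $V(G)$ are $X$-visible; $X$ is a dual mutual-visibility set if any two vertices of $X$ are $X$-visible and any two vertices of $V(G)\setminus X$ are $X$-visible. The diamond is $K_4$ minus an edge. A connected graph $G$ is a dense diamond graph if any two vertices $u,v$ with $d_G(u,v)=2$ lie on a common subgraph isomorphic to the diamond. *)

theory Defs
  imports "Graph_Theory.Graph_Theory"
begin

text \<open>
  Finite simple graphs are the library's \<^locale>\<open>graph\<close>s: finite symmetric digraphs without loops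
  and parallel arcs, each undirected edge being a pair of opposite arcs.  Paths are the library's
  arc walks with distinct vertices (\<open>apath\<close>), and the distance is the library's \<open>\<mu>\<close>, the infimum
  of the costs of all walks, with every arc weighing \<open>1\<close>.
\<close>

definition gdist :: "('a, 'b) pre_digraph \<Rightarrow> 'a \<Rightarrow> 'a \<Rightarrow> ereal" where
  "gdist G u v = wf_digraph.\<mu> G (\<lambda>_. 1) u v"

definition shortest_path :: "('a, 'b) pre_digraph \<Rightarrow> 'a \<Rightarrow> 'b awalk \<Rightarrow> 'a \<Rightarrow> bool" where
  "shortest_path G u P v \<longleftrightarrow>
     pre_digraph.apath G u P v \<and> ereal (real (length P)) = gdist G u v"

definition visible :: "('a, 'b) pre_digraph \<Rightarrow> 'a set \<Rightarrow> 'a \<Rightarrow> 'a \<Rightarrow> bool" where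
  "visible G X u v \<longleftrightarrow>
     (\<exists>P. shortest_path G u P v \<and> set (pre_digraph.awalk_verts G u P) \<inter> X \<subseteq> {u, v})"

definition total_mutual_visibility_set :: "('a, 'b) pre_digraph \<Rightarrow> 'a set \<Rightarrow> bool" where
  "total_mutual_visibility_set G X \<longleftrightarrow>
     X \<subseteq> verts G \<and> (\<forall>u \<in> verts G. \<forall>v \<in> verts G. visible G X u v)"

definition dual_mutual_visibility_set :: "('a, 'b) pre_digraph \<Rightarrow> 'a set \<Rightarrow> bool" where
  "dual_mutual_visibility_set G X \<longleftrightarrow>
     X \<subseteq> verts G \<and>
     (\<forall>u \<in> X. \<forall>v \<in> X. visible G X u v) \<and>
     (\<forall>u \<in> verts G - X. \<forall>v \<in> verts G - X. visible G X u v)"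

definition independent_set :: "('a, 'b) pre_digraph \<Rightarrow> 'a set \<Rightarrow> bool" where
  "independent_set G X \<longleftrightarrow>
     X \<subseteq> verts G \<and> (\<forall>u \<in> X. \<forall>v \<in> X. \<not> u \<rightarrow>\<^bsub>G\<^esub> v)"

definition diamond :: "(nat, nat \<times> nat) pre_digraph" where
  "diamond = with_proj
     \<lparr> pverts = {0, 1, 2, 3},
       parcs = {(i, j). i \<in> {0, 1, 2, 3} \<and> j \<in> {0, 1, 2, 3} \<and> i \<noteq> j} - {(0, 1), (1, 0)} \<rparr>"

text \<open>The library's \<^const>\<open>subgraph\<close> is not necessarily induced.\<close>

definition dense_diamond_graph :: "('a, 'b) pre_digraph \<Rightarrow> bool" where
  "dense_diamond_graph G \<longleftrightarrow>
     graph G \<and> Digraph_Component.connected G \<and>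
     (\<forall>u \<in> verts G. \<forall>v \<in> verts G. gdist G u v = 2 \<longrightarrow>
        (\<exists>H. subgraph H G \<and> digraph_iso H diamond \<and> u \<in> verts H \<and> v \<in> verts H))"

end

theory Submission
  imports Defs
begin

text \<open>
  Two vertices at distance \<open>2\<close> lie on a common diamond iff they have two adjacent common neighbours.
  If no two common neighbours of \<open>u\<close> and \<open>v\<close> are adjacent, then the common neighbours form an
  independent set that meets the interior of every shortest path from \<open>u\<close> to \<open>v\<close>.  Conversely, an
  inner vertex of a shortest path lying in an independent set can be exchanged for one of two adjacent
  common neighbours of its predecessor and its successor, because these are not both in the set.
\<close>

section \<open>Shortest paths as walks of minimal length\<close>

context wf_digraph begin

lemma dominatesE:
  assumes "u \<rightarrow>\<^bsub>G\<^esub> v"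
  obtains e where "e \<in> arcs G" "tail G e = u" "head G e = v"
  using assms by (auto simp: arcs_ends_conv)

lemma awalk_cost_one: "awalk_cost (\<lambda>_. 1) p = real (length p)"
  by (induct p) auto

lemma gdist_le_length:
  assumes "awalk u p v"
  shows "gdist G u v \<le> ereal (real (length p))"
  using min_cost_le_walk_cost[OF assms, of "\<lambda>_. 1"] by (simp add: gdist_def awalk_cost_one)

text \<open>A repeated vertex would enclose a nonempty closed subwalk, and cutting it out would give
  a walk shorter than the distance. So distinctness of the vertices never has to be rechecked when a
  piece of a shortest path is exchanged.\<close>

lemma shortest_path_iff_awalk:
  "shortest_path G u p v \<longleftrightarrow> awalk u p v \<and> ereal (real (length p)) = gdist G u v"
proof
  assume *: "awalk u p v \<and> ereal (real (length p)) = gdist G u v"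
  have "distinct (awalk_verts u p)"
  proof (rule ccontr)
    assume "\<not> distinct (awalk_verts u p)"
    with * obtain q r s w where w: "p = q @ r @ s" "0 < length r" "awalk u q w" "awalk w s v"
      using awalk_not_distinct_decomp[of u p v] by auto
    from * have "ereal (real (length p)) \<le> ereal (real (length (q @ s)))"
      using gdist_le_length[OF awalk_appendI[OF w(3,4)]] by simp
    with w(1,2) show False by simp
  qed
  with * show "shortest_path G u p v"
    by (simp add: shortest_path_def apath_def)
qed (simp add: shortest_path_def apath_def)

lemma shortest_path_length_le:
  assumes "shortest_path G u p v" "awalk u q v"
  shows "length p \<le> length q"
proof -
  have "ereal (real (length p)) \<le> ereal (real (length q))"
    using gdist_le_length[OF assms(2)] assms(1) by (simp add: shortest_path_iff_awalk)
  then show ?thesis by simp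
qed

lemma shortest_path_if_same_length:
  assumes "shortest_path G u p v" "awalk u q v" "length q = length p"
  shows "shortest_path G u q v"
  using assms by (simp add: shortest_path_iff_awalk)

end

section \<open>Distance two and rerouting around an independent set\<close>

context fin_digraph begin

lemma shortest_path_exists:
  assumes "u \<rightarrow>\<^sup>* v"
  obtains p where "shortest_path G u p v"
  using min_cost_awalk[OF assms, of "\<lambda>_. 1"]
  by (auto simp: shortest_path_def gdist_def awalk_cost_one)

text \<open>The infimum behind \<open>gdist\<close> is attained as soon as one walk exists, so
  shortest paths can be treated by comparing natural numbers instead of extended reals.\<close>

lemma shortest_path_iff_minimal:
  "shortest_path G u p v \<longleftrightarrow> awalk u p v \<and> (\<forall>q. awalk u q v \<longrightarrow> length p \<le> length q)"
proof
  assume *: "awalk u p v \<and> (\<forall>q. awalk u q v \<longrightarrow> length p \<le> length q)"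
  then obtain q where q: "shortest_path G u q v"
    using shortest_path_exists reachable_awalkI by metis
  then have "awalk u q v"
    by (simp add: shortest_path_iff_awalk)
  with * q have "length p = length q"
    using shortest_path_length_le by (meson le_antisym)
  with * q show "shortest_path G u p v"
    using shortest_path_if_same_length by blast
next
  assume *: "shortest_path G u p v"
  then show "awalk u p v \<and> (\<forall>q. awalk u q v \<longrightarrow> length p \<le> length q)"
    using shortest_path_length_le[OF *] by (simp add: shortest_path_iff_awalk)
qed

lemma shortest_path_tl:
  assumes "shortest_path G u (e # p) v"
  shows "shortest_path G (head G e) p v"
  unfolding shortest_path_iff_minimal
proof (intro conjI allI impI)
  show "awalk (head G e) p v"
    using assms by (simp add: shortest_path_iff_minimal awalk_Cons_iff)
  fix q assume "awalk (head G e) q v"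
  then have "awalk u (e # q) v"
    using assms by (simp add: shortest_path_iff_minimal awalk_Cons_iff)
  then show "length p \<le> length q"
    using shortest_path_length_le[OF assms] by force
qed

text \<open>A walk from \<open>u\<close> to \<open>head G f\<close> with fewer than two arcs,
  continued by \<open>p\<close>, would undercut the given shortest path.\<close>

lemma gdist_two_first_steps:
  assumes "shortest_path G u (e # f # p) v"
  shows "gdist G u (head G f) = 2"
proof -
  have w: "awalk u [e, f] (head G f)" "awalk (head G f) p v"
    using assms by (auto simp: shortest_path_iff_minimal awalk_simps)
  have "shortest_path G u [e, f] (head G f)"
    unfolding shortest_path_iff_minimal
  proof (intro conjI allI impI)
    fix q assume "awalk u q (head G f)"
    then have "awalk u (q @ p) v"
      using w(2) by (rule awalk_appendI)
    from shortest_path_length_le[OF assms this] show "length [e, f] \<le> length q"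
      by simp
  qed (rule w(1))
  then show ?thesis
    by (simp add: shortest_path_iff_awalk)
qed

lemma gdist_two_not_adjacent:
  assumes "gdist G u v = 2"
  shows "u \<noteq> v" "\<not> u \<rightarrow>\<^bsub>G\<^esub> v"
proof -
  have "gdist G u v \<le> 0" if "u = v" "u \<in> verts G"
    using gdist_le_length[of u "[]" v] that by (simp add: awalk_Nil_iff zero_ereal_def)
  \<comment> \<open>Outside \<open>verts G\<close> not even the empty walk exists, so the infimum is
    taken over the empty set.\<close>
  moreover have "gdist G u v = \<infinity>" if "u = v" "u \<notin> verts G"
    using that shortest_path_inf reachable_in_verts unfolding gdist_def by blast
  ultimately show "u \<noteq> v"
    using assms by (cases "u \<in> verts G") auto
  show "\<not> u \<rightarrow>\<^bsub>G\<^esub> v"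
  proof
    assume "u \<rightarrow>\<^bsub>G\<^esub> v"
    then obtain e where "e \<in> arcs G" "tail G e = u" "head G e = v"
      by (rule dominatesE)
    then show False
      using gdist_le_length[of u "[e]" v] assms by (auto simp: awalk_simps)
  qed
qed

text \<open>The path is repaired from its start: if the first inner vertex lies in \<open>X\<close>,
  it is exchanged for one outside \<open>X\<close>. The induction hypothesis then repairs the rest,
  whose start is the vertex just fixed.\<close>

lemma visible_if_adjacent_common_neighbours:
  assumes cn: "\<And>x y. gdist G x y = 2 \<Longrightarrow> \<exists>a b. x \<rightarrow>\<^bsub>G\<^esub> a \<and> a \<rightarrow>\<^bsub>G\<^esub> y \<and> x \<rightarrow>\<^bsub>G\<^esub> b \<and> b \<rightarrow>\<^bsub>G\<^esub> y \<and> a \<rightarrow>\<^bsub>G\<^esub> b"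
    and X: "independent_set G X"
    and p: "shortest_path G u p v"
  shows "visible G X u v"
  using p
proof (induct "length p" arbitrary: u p)
  case 0
  then show ?case
    by (auto simp: visible_def intro!: exI[of _ "[]"])
next
  case (Suc n)
  \<comment> \<open>The induction hypothesis tolerates \<open>head G e\<close> in \<open>X\<close>,
    because it is an endpoint of the remaining path. In the longer path it is an inner vertex unless
    it equals \<open>v\<close>, which explains the third premise.\<close>
  have step: "visible G X u v"
    if q: "shortest_path G u (e # q) v" "length q = n" "head G e \<in> X \<Longrightarrow> head G e = v" for e q
  proof -
    have t: "tail G e = u" "e \<in> arcs G"
      using q(1) by (auto simp: shortest_path_iff_awalk awalk_Cons_iff)
    from q(1) have q': "shortest_path G (head G e) q v"
      by (rule shortest_path_tl)
    then obtain r where r: "shortest_path G (head G e) r v"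
      "set (awalk_verts (head G e) r) \<inter> X \<subseteq> {head G e, v}"
      using Suc(1)[OF q(2)[symmetric]] unfolding visible_def by blast
    have "length r = length q"
      using q' r(1) by (auto simp: shortest_path_iff_minimal intro: le_antisym)
    then have "shortest_path G u (e # r) v"
      using shortest_path_if_same_length[OF q(1), of "e # r"] r(1) t
      by (simp add: shortest_path_iff_awalk awalk_Cons_iff)
    moreover have "set (awalk_verts u (e # r)) \<inter> X \<subseteq> {u, v}"
      using r(2) q(3) t by auto
    ultimately show ?thesis
      unfolding visible_def by blast
  qed
  obtain e es where p: "p = e # es"
    using Suc(2) by (cases p) auto
  show ?case
  proof (cases "head G e \<in> X \<and> es \<noteq> []")
    case False
    moreover have "head G e = v" if "es = []"
      using Suc(3) that p by (simp add: shortest_path_iff_awalk awalk_simps)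
    ultimately show ?thesis
      using step Suc(2,3) p by auto
  next
    case True
    then obtain f fs where fs: "es = f # fs"
      by (cases es) auto
    have "gdist G u (head G f) = 2"
      using gdist_two_first_steps Suc(3) p fs by blast
    \<comment> \<open>Of the two adjacent common neighbours supplied by \<open>cn\<close>,
      independence leaves at least one outside \<open>X\<close>.\<close>
    then obtain w where w: "u \<rightarrow>\<^bsub>G\<^esub> w" "w \<rightarrow>\<^bsub>G\<^esub> head G f" "w \<notin> X"
      using cn X unfolding independent_set_def by blast
    obtain g where g: "g \<in> arcs G" "tail G g = u" "head G g = w"
      using w(1) by (rule dominatesE)
    obtain h where h: "h \<in> arcs G" "tail G h = w" "head G h = head G f"
      using w(2) by (rule dominatesE)
    have "shortest_path G u (g # h # fs) v"
      using Suc(3) g h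
      by (intro shortest_path_if_same_length[OF Suc(3)])
        (auto simp: p fs shortest_path_iff_awalk awalk_Cons_iff)
    then show ?thesis
      using step[of g "h # fs"] Suc(2) w(3) g p fs by auto
  qed
qed

end

section \<open>Diamonds and adjacent common neighbours\<close>

context graph begin

text \<open>The only distinct vertices of \<open>diamond\<close> that are not adjacent are
  \<open>0\<close> and \<open>1\<close>, so \<open>u\<close> and \<open>v\<close> must correspond to
  these. The vertices corresponding to \<open>2\<close> and \<open>3\<close> are then the required
  neighbours.\<close>

lemma diamond_imp_adjacent_common_neighbours:
  assumes H: "subgraph H G" "digraph_iso H diamond" "u \<in> verts H" "v \<in> verts H"
    and uv: "u \<noteq> v" "\<not> u \<rightarrow>\<^bsub>G\<^esub> v"
  shows "\<exists>a b. u \<rightarrow>\<^bsub>G\<^esub> a \<and> a \<rightarrow>\<^bsub>G\<^esub> v \<and> u \<rightarrow>\<^bsub>G\<^esub> b \<and> b \<rightarrow>\<^bsub>G\<^esub> v \<and> a \<rightarrow>\<^bsub>G\<^esub> b"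
proof -
  interpret H: wf_digraph H
    using H(1) by (simp add: subgraph_def)
  obtain hom where hom: "H.digraph_isomorphism hom" and D: "diamond = app_iso hom H"
    using H(2) unfolding digraph_iso_def by blast
  let ?h = "iso_verts hom"
  have inj: "inj_on ?h (verts H)"
    using hom by (rule H.digraph_isomorphism_inj_on_verts)
  have V: "?h ` verts H = {0, 1, 2, 3}"
    using arg_cong[OF D, of verts] by (simp add: diamond_def)
  have "arcs_ends diamond = (\<lambda>(x, y). (?h x, ?h y)) ` arcs_ends H"
    unfolding D by (rule H.arcs_ends_app_iso_eq[OF hom])
  then have A: "(\<lambda>(x, y). (?h x, ?h y)) ` arcs_ends H =
      {(i, j). i \<in> {0, 1, 2, 3} \<and> j \<in> {0, 1, 2, 3} \<and> i \<noteq> j} - {(0, 1), (1, 0)}"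
    by (simp add: diamond_def)
  \<comment> \<open>Adjacency is pulled back from \<open>diamond\<close> to \<open>H\<close> by
    injectivity and passes from the subgraph up to \<open>G\<close>.\<close>
  have adj: "x \<rightarrow>\<^bsub>G\<^esub> y"
    if "x \<in> verts H" "y \<in> verts H" "?h x \<noteq> ?h y" "(?h x, ?h y) \<notin> {(0, 1), (1, 0)}" for x y
  proof -
    have "?h x \<in> {0, 1, 2, 3}" "?h y \<in> {0, 1, 2, 3}"
      using that(1,2) V by blast+
    then have "(?h x, ?h y) \<in> (\<lambda>(x, y). (?h x, ?h y)) ` arcs_ends H"
      unfolding A using that(3,4) by simp
    then obtain x' y' where *: "(x', y') \<in> arcs_ends H" "?h x' = ?h x" "?h y' = ?h y"
      by auto
    with inj that(1,2) have "x' = x" "y' = y"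
      using H.adj_in_verts[OF *(1)] by (auto dest: inj_onD)
    with *(1) H(1) show "x \<rightarrow>\<^bsub>G\<^esub> y"
      using adj_mono by blast
  qed
  have "2 \<in> ?h ` verts H" "3 \<in> ?h ` verts H"
    unfolding V by simp_all
  then obtain a b where ab: "a \<in> verts H" "?h a = 2" "b \<in> verts H" "?h b = 3"
    by (metis imageE)
  have "?h u \<noteq> ?h v"
    using inj H(3,4) uv(1) by (auto dest: inj_onD)
  then have "(?h u, ?h v) \<in> {(0, 1), (1, 0)}"
    using adj[OF H(3,4)] uv(2) by (rule_tac ccontr) simp
  then have "u \<rightarrow>\<^bsub>G\<^esub> a" "a \<rightarrow>\<^bsub>G\<^esub> v" "u \<rightarrow>\<^bsub>G\<^esub> b" "b \<rightarrow>\<^bsub>G\<^esub> v" "a \<rightarrow>\<^bsub>G\<^esub> b"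
    using H(3,4) ab by (auto intro!: adj)
  then show ?thesis
    by blast
qed

text \<open>The four vertices induce a diamond: all pairs are adjacent except \<open>u\<close> and
  \<open>v\<close>.\<close>

lemma adjacent_common_neighbours_imp_diamond:
  assumes uv: "u \<noteq> v" "\<not> u \<rightarrow>\<^bsub>G\<^esub> v"
    and ab: "u \<rightarrow>\<^bsub>G\<^esub> a" "a \<rightarrow>\<^bsub>G\<^esub> v" "u \<rightarrow>\<^bsub>G\<^esub> b" "b \<rightarrow>\<^bsub>G\<^esub> v" "a \<rightarrow>\<^bsub>G\<^esub> b"
  shows "\<exists>H. subgraph H G \<and> digraph_iso H diamond \<and> u \<in> verts H \<and> v \<in> verts H"
proof -
  let ?S = "{u, v, a, b}"
  let ?H = "G \<restriction> ?S"
  have irrefl: "\<not> x \<rightarrow>\<^bsub>G\<^esub> x" for x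
    using adj_not_same by blast
  have ba: "v \<rightarrow>\<^bsub>G\<^esub> a" "a \<rightarrow>\<^bsub>G\<^esub> u" "v \<rightarrow>\<^bsub>G\<^esub> b" "b \<rightarrow>\<^bsub>G\<^esub> u" "b \<rightarrow>\<^bsub>G\<^esub> a" "\<not> v \<rightarrow>\<^bsub>G\<^esub> u"
    using ab uv(2) graph_symmetric by blast+
  have ne: "u \<noteq> a" "u \<noteq> b" "v \<noteq> a" "v \<noteq> b" "a \<noteq> b"
    using ab irrefl by blast+
  define f where "f x = (if x = u then 0 else if x = v then 1 else if x = a then 2 else 3 :: nat)" for x
  have f: "f u = 0" "f v = 1" "f a = 2" "f b = 3"
    using uv(1) ne by (simp_all add: f_def)
  then have inj: "inj_on f ?S"
    by (auto simp: inj_on_def)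
  \<comment> \<open>Arcs are sent to pairs of endpoint images, with \<open>fst\<close> and
    \<open>snd\<close> as new tail and head, since \<open>app_iso\<close> has to yield
    \<open>diamond\<close> itself as a record.\<close>
  let ?hom = "\<lparr>iso_verts = f, iso_arcs = (\<lambda>e. (f (tail G e), f (head G e))),
    iso_head = snd, iso_tail = fst\<rparr>"
  have S: "?S \<subseteq> verts G"
    using ab by (auto dest: adj_in_verts)
  have sub: "subgraph ?H G"
    using S by (rule subgraph_induce_subgraphI)
  interpret H: wf_digraph ?H
    using sub by (simp add: subgraph_def)
  \<comment> \<open>An arc is determined by its two ends because \<open>G\<close> has no parallel
    arcs.\<close>
  have "inj_on (iso_arcs ?hom) (arcs ?H)"
  proof (rule inj_onI)
    fix e1 e2 assume *: "e1 \<in> arcs ?H" "e2 \<in> arcs ?H" "iso_arcs ?hom e1 = iso_arcs ?hom e2"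
    have "tail G e1 = tail G e2" "head G e1 = head G e2"
      by (rule inj_onD[OF inj]; use * in simp)+
    with * show "e1 = e2"
      by (intro no_multi_arcs) (simp_all add: arc_to_ends_def)
  qed
  then have iso: "H.digraph_isomorphism ?hom"
    unfolding H.digraph_isomorphism_def using inj H.wf_digraph by simp
  have ends: "arcs_ends ?H = arcs_ends G \<inter> ?S \<times> ?S"
    by (auto simp: arcs_ends_conv)
  have ends_eq: "arcs_ends ?H =
    {(u, a), (u, b), (a, u), (a, v), (a, b), (v, a), (v, b), (b, u), (b, v), (b, a)}"
    unfolding ends by (auto simp: ab ba uv(2) irrefl)
  have "iso_arcs ?hom ` arcs ?H = (\<lambda>(x, y). (f x, f y)) ` arcs_ends ?H"
    by (simp add: arcs_ends_conv image_image)
  also have "\<dots> = {(i, j). i \<in> {0, 1, 2, 3} \<and> j \<in> {0, 1, 2, 3} \<and> i \<noteq> j} - {(0, 1), (1, 0)}"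
    unfolding ends_eq by (auto simp: f)
  finally have "app_iso ?hom ?H = diamond"
    using f by (simp add: app_iso_def diamond_def with_proj_def)
  with iso sub show ?thesis
    unfolding digraph_iso_def by (intro exI[of _ ?H]) (auto intro: exI[of _ ?hom])
qed

lemma adjacent_common_neighbours_if_dual:
  assumes dual: "\<And>X. independent_set G X \<Longrightarrow> dual_mutual_visibility_set G X"
    and uv: "gdist G u v = 2" "u \<in> verts G" "v \<in> verts G"
  shows "\<exists>a b. u \<rightarrow>\<^bsub>G\<^esub> a \<and> a \<rightarrow>\<^bsub>G\<^esub> v \<and> u \<rightarrow>\<^bsub>G\<^esub> b \<and> b \<rightarrow>\<^bsub>G\<^esub> v \<and> a \<rightarrow>\<^bsub>G\<^esub> b"
proof (rule ccontr)
  assume no: "\<nexists>a b. u \<rightarrow>\<^bsub>G\<^esub> a \<and> a \<rightarrow>\<^bsub>G\<^esub> v \<and> u \<rightarrow>\<^bsub>G\<^esub> b \<and> b \<rightarrow>\<^bsub>G\<^esub> v \<and> a \<rightarrow>\<^bsub>G\<^esub> b"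
  let ?C = "{c. u \<rightarrow>\<^bsub>G\<^esub> c \<and> c \<rightarrow>\<^bsub>G\<^esub> v}"
  have "independent_set G ?C"
    using no by (auto simp: independent_set_def dest: adj_in_verts)
  then have "dual_mutual_visibility_set G ?C"
    by (rule dual)
  \<comment> \<open>There are no loops, so both vertices lie outside \<open>?C\<close>, and the
    clause on pairs outside the set provides the visibility.\<close>
  moreover have "u \<notin> ?C" "v \<notin> ?C"
    using adj_not_same by blast+
  ultimately have "visible G ?C u v"
    using uv by (auto simp: dual_mutual_visibility_set_def)
  then obtain p where p: "shortest_path G u p v" "set (awalk_verts u p) \<inter> ?C \<subseteq> {u, v}"
    unfolding visible_def by blast
  have "ereal (real (length p)) = 2"
    using p(1) uv(1) by (simp add: shortest_path_def)
  then have "length p = 2"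
    by simp
  then obtain e f where ef: "p = [e, f]"
    by (auto simp: length_Suc_conv numeral_2_eq_2)
  then have "awalk u [e, f] v"
    using p(1) by (simp add: shortest_path_iff_awalk)
  then have "head G e \<in> ?C"
    using in_arcs_imp_in_arcs_ends[of e] in_arcs_imp_in_arcs_ends[of f] by (auto simp: awalk_simps)
  moreover have "head G e \<in> set (awalk_verts u p)"
    using \<open>awalk u [e, f] v\<close> by (auto simp: ef awalk_simps)
  ultimately show False
    using p(2) \<open>u \<notin> ?C\<close> \<open>v \<notin> ?C\<close> by blast
qed

end

lemma total_imp_dual_mutual_visibility_set:
  "total_mutual_visibility_set G X \<Longrightarrow> dual_mutual_visibility_set G X"
  by (auto simp: total_mutual_visibility_set_def dual_mutual_visibility_set_def)

theorem theorem4p1: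
  fixes G :: "('a, 'b) pre_digraph"
  assumes "graph G" and "Digraph_Component.connected G"
  shows "((\<forall>X. independent_set G X \<longrightarrow> total_mutual_visibility_set G X) \<longleftrightarrow>
          (\<forall>X. independent_set G X \<longrightarrow> dual_mutual_visibility_set G X)) \<and>
         ((\<forall>X. independent_set G X \<longrightarrow> dual_mutual_visibility_set G X) \<longleftrightarrow>
          dense_diamond_graph G)"
proof -
  interpret graph G
    by (rule assms(1))
  \<comment> \<open>Connectedness is strong connectedness of the symmetric closure; as the arcs are
    already symmetric, it yields directed reachability in \<open>G\<close> itself.\<close>
  have reach: "u \<rightarrow>\<^sup>*\<^bsub>G\<^esub> v" if "u \<in> verts G" "v \<in> verts G" for u v
    using symmetric_connected_imp_strongly_connected[OF sym_arcs assms(2)] that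
    by (simp add: strongly_connected_def)
  have "dense_diamond_graph G"
    if dual: "\<forall>X. independent_set G X \<longrightarrow> dual_mutual_visibility_set G X"
    unfolding dense_diamond_graph_def
  proof (intro conjI ballI impI)
    fix u v assume *: "u \<in> verts G" "v \<in> verts G" "gdist G u v = 2"
    obtain a b where "u \<rightarrow>\<^bsub>G\<^esub> a" "a \<rightarrow>\<^bsub>G\<^esub> v" "u \<rightarrow>\<^bsub>G\<^esub> b" "b \<rightarrow>\<^bsub>G\<^esub> v" "a \<rightarrow>\<^bsub>G\<^esub> b"
      using adjacent_common_neighbours_if_dual[OF dual[rule_format] *(3,1,2)] by blast
    with gdist_two_not_adjacent[OF *(3)]
    show "\<exists>H. subgraph H G \<and> digraph_iso H diamond \<and> u \<in> verts H \<and> v \<in> verts H"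
      by (rule adjacent_common_neighbours_imp_diamond)
  qed (rule assms)+
  moreover have "total_mutual_visibility_set G X"
    if dd: "dense_diamond_graph G" and X: "independent_set G X" for X
  proof -
    have cn: "\<exists>a b. x \<rightarrow>\<^bsub>G\<^esub> a \<and> a \<rightarrow>\<^bsub>G\<^esub> y \<and> x \<rightarrow>\<^bsub>G\<^esub> b \<and> b \<rightarrow>\<^bsub>G\<^esub> y \<and> a \<rightarrow>\<^bsub>G\<^esub> b" if xy: "gdist G x y = 2" for x y
    proof -
      \<comment> \<open>The distance is finite, so a walk exists and both ends are vertices, as the
        definition of \<open>dense_diamond_graph\<close> demands.\<close>
      have "x \<rightarrow>\<^sup>*\<^bsub>G\<^esub> y"
        using xy \<mu>_reach_conv[of "\<lambda>_. 1" x y] by (simp add: gdist_def)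
      then have "x \<in> verts G" "y \<in> verts G"
        by (auto dest: reachable_in_verts)
      then obtain H where "subgraph H G" "digraph_iso H diamond" "x \<in> verts H" "y \<in> verts H"
        using dd xy unfolding dense_diamond_graph_def by blast
      then show ?thesis
        using gdist_two_not_adjacent[OF xy] by (rule diamond_imp_adjacent_common_neighbours)
    qed
    have "visible G X u v" if uv: "u \<in> verts G" "v \<in> verts G" for u v
    proof -
      obtain p where "shortest_path G u p v"
        using reach[OF uv] by (rule shortest_path_exists)
      with cn X show ?thesis
        by (rule visible_if_adjacent_common_neighbours)
    qed
    with X show ?thesis
      by (simp add: total_mutual_visibility_set_def independent_set_def)
  qed
  \<comment> \<open>The cycle total, dual, dense diamond, total is now closed.\<close>
  ultimately show ?thesis
    using total_imp_dual_mutual_visibility_set by blast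
qed

end
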